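(* Let $n$ be a natural number, let $G$ be a subgroup of the additive group of the $n$-dimensional vector space $\mathbb{Q}^n\subset\mathbb{R}^n$ over the rational numbers, and let $\succ$ be a total order on $G$. Then $\succ$ is compatible with addition if and only if $\succ$ is induced from some lexicographic order $\succ_{\mathbf{x}}$ on $\mathbb{R}^n$, i.e. if and only if there is a coordinate system $\mathbf{x}=(x_1,\dots,x_n)$ on $\mathbb{R}^n$ such that for all $a,b\in G$: $a\succ b \Leftrightarrow a\succ_{\mathbf{x}} b$.
   Context: A total order is understood as a strict total order. A total order $\succ$ on a commutative semigroup (or group) $S$ is compatible with addition if for all $x,y,a\in S$ with $x\succ y$ one has $x+a\succ y+a$. A coordinate system $\mathbf{x}=(x_1,\dots,x_n)$ on an $n$-dimensional real vector space $L$ is the ordered tuple of coordinate functions (linear functions $L\to\mathbb{R}$) associated with an ordered basis $e_1,\dots,e_n$ of $L$ (an arbitrary real basis). The lexicographic order $\succ_{\mathbf{x}}$ related to $\mathbf{x}$ is: for distinct $a,b\in L$, $a\succ_{\mathbf{x}} b$ if and only if $x_i(a)>x_i(b)$, where $i$ is the smallest index with $x_i(a)\neq x_i(b)$. *)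

theory Defs
  imports "HOL-Analysis.Analysis" "HOL-Algebra.Group"
begin

definition rational_vectors :: "(real ^ 'n) monoid" where
  "rational_vectors =
    \<lparr>carrier = {v. \<forall>i. v $ i \<in> \<rat>}, monoid.mult = (+), one = 0\<rparr>"

lemma comm_group_rational_vectors:
  "comm_group (rational_vectors :: (real ^ 'n) monoid)"
proof (rule comm_groupI)
  fix v :: "real ^ 'n"
  assume "v \<in> carrier rational_vectors"
  then have "- v \<in> carrier rational_vectors" "- v \<otimes>\<^bsub>rational_vectors\<^esub> v = \<one>\<^bsub>rational_vectors\<^esub>"
    by (simp_all add: rational_vectors_def)
  then show "\<exists>w\<in>carrier rational_vectors. w \<otimes>\<^bsub>rational_vectors\<^esub> v = \<one>\<^bsub>rational_vectors\<^esub>"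
    by blast
qed (simp_all add: rational_vectors_def add.commute add.left_commute)

definition strict_total_order_on :: "'a set \<Rightarrow> ('a \<Rightarrow> 'a \<Rightarrow> bool) \<Rightarrow> bool" where
  "strict_total_order_on S gt \<longleftrightarrow> irreflp_on S gt \<and> transp_on S gt \<and> totalp_on S gt"

definition compatible_with_addition :: "'a::ab_semigroup_add set \<Rightarrow> ('a \<Rightarrow> 'a \<Rightarrow> bool) \<Rightarrow> bool" where
  "compatible_with_addition S gt \<longleftrightarrow>
    (\<forall>x\<in>S. \<forall>y\<in>S. \<forall>a\<in>S. gt x y \<longrightarrow> gt (x + a) (y + a))"

definition ordered_basis :: "'a::real_vector list \<Rightarrow> bool" where
  "ordered_basis es \<longleftrightarrow> distinct es \<and> independent (set es) \<and> span (set es) = UNIV"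

definition coordinate_system :: "('a::real_vector \<Rightarrow> real) list \<Rightarrow> bool" where
  "coordinate_system xs \<longleftrightarrow>
    (\<exists>es. ordered_basis es \<and> xs = map (\<lambda>e v. representation (set es) v e) es)"

text \<open>Coordinates are indexed from 0. When \<open>xs\<close> is a coordinate system and
  \<open>a \<noteq> b\<close>, some coordinate separates \<open>a\<close> and \<open>b\<close>, so the \<open>LEAST\<close> below is attained.\<close>

definition lex_greater :: "('a \<Rightarrow> real) list \<Rightarrow> 'a \<Rightarrow> 'a \<Rightarrow> bool" where
  "lex_greater xs a b \<longleftrightarrow> a \<noteq> b \<and>
    (let i = (LEAST i. i < length xs \<and> (xs ! i) a \<noteq> (xs ! i) b) in (xs ! i) a > (xs ! i) b)"

end

theory Submission
  imports Defs
begin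

text \<open>Let \<open>P\<close> be the set of positive elements of a compatible order. If \<open>0\<close> were a convex
  combination of elements of \<open>P\<close>, then simultaneous Diophantine approximation of its coefficients
  would give a nontrivial relation with natural coefficients: the approximating combination of
  rational vectors has a bounded denominator and is arbitrarily small, hence vanishes. This is
  impossible, as \<open>P\<close> is closed under addition. So the convex hull of \<open>P\<close> avoids \<open>0\<close> and lies in a
  closed half-space; on the bounding hyperplane one repeats the separation, and the successive
  unit normals form the required basis.\<close>

section \<open>Lexicographic positivity on convex sets\<close>

text \<open>The explicit index, instead of a \<open>LEAST\<close>, lets a vector be put in front of
  the list by a mere shift.\<close>

definition lex_pos :: "'a::real_inner list \<Rightarrow> 'a \<Rightarrow> bool" where
  "lex_pos es v \<longleftrightarrow> (\<exists>i<length es. v \<bullet> es ! i > 0 \<and> (\<forall>j<i. v \<bullet> es ! j = 0))"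

lemma lex_pos_Cons: "lex_pos (e # es) v" if "v \<bullet> e > 0 \<or> v \<bullet> e = 0 \<and> lex_pos es v"
  using that
proof
  assume "v \<bullet> e > 0"
  then show ?thesis unfolding lex_pos_def by (intro exI[of _ 0]) auto
next
  assume "v \<bullet> e = 0 \<and> lex_pos es v"
  then obtain i where "v \<bullet> e = 0" "i < length es" "v \<bullet> es ! i > 0" "\<forall>j<i. v \<bullet> es ! j = 0"
    by (auto simp: lex_pos_def)
  then show ?thesis unfolding lex_pos_def
    by (intro exI[of _ "Suc i"]) (auto simp: nth_Cons split: nat.split)
qed

text \<open>Induction on \<open>dim V\<close>, which is why a general subspace appears. A unit
  normal \<open>e\<close> decides the points of \<open>C\<close> off its hyperplane
  \<open>H\<close>. The others form a convex set in \<open>V \<inter> H\<close>, still without 0,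
  and the induction hypothesis decides them. Since \<open>V\<close> is exhausted even when no points
  of \<open>C\<close> are left, the list ends up as a full basis.\<close>

lemma convex_lex_pos_orthonormal:
  fixes V C :: "'a::euclidean_space set"
  assumes "subspace V" "convex C" "C \<subseteq> V" "0 \<notin> C"
  shows "\<exists>es. distinct es \<and> pairwise orthogonal (set es) \<and> (\<forall>e\<in>set es. norm e = 1)
    \<and> span (set es) = V \<and> (\<forall>c\<in>C. lex_pos es c)"
  using assms
proof (induction "dim V" arbitrary: V C rule: less_induct)
  case less
  show ?case
  proof (cases "V \<subseteq> {0}")
    case True
    then have "V = {0}" "C = {}" using less.prems subspace_0 by blast+
    then show ?thesis by (intro exI[of _ "[]"]) auto
  next
    case False
    \<comment> \<open>The normal has to lie in \<open>V\<close>, so the separation theorem with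
      normal in \<open>span C\<close> is used. For empty \<open>C\<close> any nonzero vector of
      \<open>V\<close> serves.\<close>
    obtain a where a: "a \<in> V" "a \<noteq> 0" "\<forall>x\<in>C. 0 \<le> a \<bullet> x"
    proof (cases "C = {}")
      case True
      then show ?thesis using False that by blast
    next
      case nonempty: False
      obtain a where "a \<in> span C" "a \<noteq> 0" "\<And>x. x \<in> C \<Longrightarrow> 0 \<le> a \<bullet> x"
        using separating_hyperplane_set_0_inspan[OF less.prems(2) nonempty less.prems(4)] by metis
      moreover have "span C \<subseteq> V" using less.prems span_minimal by blast
      ultimately show ?thesis using that by blast
    qed
    define e where "e = a /\<^sub>R norm a"
    have e: "e \<in> V" "norm e = 1" "e \<bullet> e = 1" "\<And>x. x \<in> C \<Longrightarrow> 0 \<le> x \<bullet> e"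
      using a less.prems(1)
      by (auto simp: e_def subspace_scale inner_commute dot_square_norm power2_eq_square)
    define H where "H = {x. e \<bullet> x = 0}"
    have H: "subspace H" unfolding H_def by (rule subspace_hyperplane)
    have VH: "subspace (V \<inter> H)" using less.prems(1) H by (rule subspace_inter)
    have "e \<notin> H" using e by (simp add: H_def)
    then have "V \<inter> H \<subset> V" using e by blast
    then have dim: "dim (V \<inter> H) < dim V"
      by (intro dim_psubset) (metis VH less.prems(1) span_eq_iff)
    have "convex (C \<inter> H)" using less.prems(2) H by (simp add: convex_Int subspace_imp_convex)
    then obtain es where es: "distinct es" "pairwise orthogonal (set es)"
      "\<forall>e\<in>set es. norm e = 1" "span (set es) = V \<inter> H" "\<forall>c\<in>C \<inter> H. lex_pos es c"
      using less.hyps[OF dim VH, of "C \<inter> H"] less.prems by blast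
    have sub: "set es \<subseteq> V \<inter> H" using es(4) span_superset by blast
    have "v \<in> span (insert e (set es))" if "v \<in> V" for v
    proof -
      \<comment> \<open>Removing the component along \<open>e\<close> projects \<open>V\<close> onto
        \<open>V \<inter> H\<close>, which \<open>es\<close> spans.\<close>
      have "v - (v \<bullet> e) *\<^sub>R e \<in> V \<inter> H"
        using that e less.prems(1)
        by (auto simp: H_def subspace_diff subspace_scale inner_diff_right inner_commute)
      then show ?thesis unfolding span_insert es(4) by blast
    qed
    moreover have "span (insert e (set es)) \<subseteq> V"
      using sub e less.prems(1) by (intro span_minimal) auto
    ultimately have "span (set (e # es)) = V" by auto
    moreover have "distinct (e # es)" using es(1) sub \<open>e \<notin> H\<close> by auto
    moreover have "pairwise orthogonal (set (e # es))"
      using es(2) sub by (auto simp: pairwise_insert orthogonal_def H_def inner_commute)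
    moreover have "\<forall>c\<in>C. lex_pos (e # es) c"
    proof
      fix c assume "c \<in> C"
      then show "lex_pos (e # es) c"
        using es(5) e(4)[of c] by (intro lex_pos_Cons) (auto simp: H_def inner_commute)
    qed
    ultimately show ?thesis using es(3) e(2)
      by (intro exI[of _ "e # es"]) auto
  qed
qed

text \<open>Links the inner products of \<open>lex_pos\<close> to the coordinate functions in
  \<open>coordinate_system\<close>: pairing the expansion of \<open>v\<close> with \<open>e\<close>
  leaves one term.\<close>

lemma orthonormal_representation:
  assumes "finite B" "pairwise orthogonal B" "\<And>b. b \<in> B \<Longrightarrow> norm b = 1"
    "independent B" "v \<in> span B" "e \<in> B"
  shows "representation B v e = v \<bullet> e"
proof -
  have "v \<bullet> e = (\<Sum>b\<in>B. representation B v b *\<^sub>R b) \<bullet> e"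
    using assms by (simp add: sum_representation_eq)
  also have "\<dots> = (\<Sum>b\<in>B. representation B v b * (b \<bullet> e))"
    by (simp add: inner_sum_left)
  also have "\<dots> = (\<Sum>b\<in>B. if b = e then representation B v e else 0)"
    using assms by (intro sum.cong) (auto simp: pairwise_def orthogonal_def dot_square_norm)
  also have "\<dots> = representation B v e" using assms by simp
  finally show ?thesis by simp
qed

section \<open>Lexicographic orders\<close>

lemma lex_pos_imp_lex_greater:
  assumes "lex_pos es (a - b)"
  shows "lex_greater (map (\<lambda>e v. v \<bullet> e) es) a b"
proof -
  obtain i where i: "i < length es" "(a - b) \<bullet> es ! i > 0" "\<forall>j<i. (a - b) \<bullet> es ! j = 0"
    using assms by (auto simp: lex_pos_def)
  let ?xs = "map (\<lambda>e v. v \<bullet> e) es"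
  have "(LEAST i. i < length ?xs \<and> (?xs ! i) a \<noteq> (?xs ! i) b) = i"
    using i by (intro Least_equality) (auto simp: inner_diff_left not_less[symmetric])
  then show ?thesis using i by (auto simp: lex_greater_def inner_diff_left Let_def)
qed

text \<open>The condition under \<open>LEAST\<close> is symmetric in \<open>a\<close> and
  \<open>b\<close>, so both comparisons look at the same coordinate.\<close>

lemma lex_greater_asym: "lex_greater xs a b \<Longrightarrow> \<not> lex_greater xs b a"
  by (auto simp: lex_greater_def Let_def eq_commute)

text \<open>Translation by \<open>c\<close> preserves the set of separating indices, hence its least
  element.\<close>

lemma lex_greater_add:
  fixes a b c :: "'a::ab_group_add" and xs :: "('a \<Rightarrow> real) list"
  assumes "\<And>x. x \<in> set xs \<Longrightarrow> x (a + c) = x a + x c \<and> x (b + c) = x b + x c"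
    and "\<exists>i<length xs. (xs ! i) a \<noteq> (xs ! i) b" "lex_greater xs a b"
  shows "lex_greater xs (a + c) (b + c)"
proof -
  have eq: "i < length xs \<and> (xs ! i) (a + c) \<noteq> (xs ! i) (b + c) \<longleftrightarrow>
      i < length xs \<and> (xs ! i) a \<noteq> (xs ! i) b" for i
    using assms(1)[OF nth_mem, of i] by auto
  define k where "k = (LEAST i. i < length xs \<and> (xs ! i) a \<noteq> (xs ! i) b)"
  \<comment> \<open>Only because some index separates is \<open>LEAST\<close> attained; additivity
    is known just for entries of the list.\<close>
  have "k < length xs" unfolding k_def using LeastI_ex[OF assms(2)] by blast
  then show ?thesis using assms(1)[OF nth_mem, of k] assms(3)
    unfolding lex_greater_def eq Let_def by (simp flip: k_def)
qed

section \<open>Diophantine approximation and relations between rational vectors\<close>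

lemma common_denominator:
  assumes "finite A" "A \<subseteq> (\<rat> :: real set)"
  shows "\<exists>d::nat. d > 0 \<and> (\<forall>a\<in>A. of_nat d * a \<in> \<int>)"
  using assms
proof (induction rule: finite_induct)
  case empty
  show ?case by auto
next
  case (insert x A)
  then obtain d :: nat where d: "d > 0" "\<forall>a\<in>A. of_nat d * a \<in> \<int>" by auto
  obtain m n :: int where mn: "n > 0" "x = of_int m / of_int n"
    using insert.prems by (auto elim!: Rats_cases')
  have "real (d * nat n) * x = of_int (int d * m)" using mn by simp
  moreover have "real (d * nat n) * a \<in> \<int>" if "a \<in> A" for a
  proof -
    have "of_int n * (real d * a) \<in> \<int>" using d that by auto
    then show ?thesis using mn by (simp add: mult_ac)
  qed
  ultimately show ?case using d(1) mn(1)
    by (intro exI[of _ "d * nat n"]) (auto simp only: Ints_of_int insert_iff mult_pos_pos zero_less_nat_eq)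
qed

lemma nat_relation_of_convex_relation:
  fixes x :: "nat \<Rightarrow> real ^ 'n"
  assumes u: "\<And>i. i < k \<Longrightarrow> u i \<ge> (0::real)" "(\<Sum>i<k. u i) = 1"
    and x: "\<And>i j. i < k \<Longrightarrow> x i $ j \<in> \<rat>" "(\<Sum>i<k. u i *\<^sub>R x i) = 0"
  shows "\<exists>m :: nat \<Rightarrow> nat. (\<exists>i<k. m i \<noteq> 0) \<and> (\<Sum>i<k. real (m i) *\<^sub>R x i) = 0"
proof -
  obtain d :: nat where d: "d > 0" "\<And>i j. i < k \<Longrightarrow> real d * x i $ j \<in> \<int>"
  proof -
    let ?A = "(\<lambda>(i, j). x i $ j) ` ({..<k} \<times> UNIV)"
    have "finite ?A" "?A \<subseteq> \<rat>" using x(1) by auto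
    then obtain d where "d > 0" "\<forall>a\<in>?A. real d * a \<in> \<int>" using common_denominator by blast
    then show ?thesis using that by auto
  qed
  define M where "M = (\<Sum>i<k. \<Sum>j\<in>UNIV. real d * \<bar>x i $ j\<bar>)"
  have "M \<ge> 0" unfolding M_def by (intro sum_nonneg) auto
  \<comment> \<open>\<open>N > M\<close> will force the integral error in each coordinate below 1,
    and \<open>N > k\<close> will keep the \<open>p i\<close> from all vanishing.\<close>
  define N where "N = nat \<lceil>M\<rceil> + k + 1"
  have N: "real N > M" "real N > k" "N > 0" using \<open>M \<ge> 0\<close> unfolding N_def by linarith+
  obtain q p where q: "0 < q"
    and p: "\<And>i. i < k \<Longrightarrow> \<bar>of_int q * u i - of_int (p i)\<bar> < 1 / real N"
    using Dirichlet_approx_simult[OF N(3), of k u] by metis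
  \<comment> \<open>An integer within distance 1 of a nonnegative real is nonnegative.\<close>
  have pos: "p i \<ge> 0" if "i < k" for i
  proof -
    have "of_int q * u i \<ge> 0" using u(1)[OF that] q by simp
    moreover have "1 / real N \<le> 1" using N(3) by simp
    ultimately have "real_of_int (p i) > -1" using p[OF that] by linarith
    then show ?thesis by linarith
  qed
  have "(\<Sum>i<k. real_of_int (p i)) > 0"
  proof -
    \<comment> \<open>As the \<open>u i\<close> sum to 1, the left side is \<open>q - k / N\<close>,
      which is positive.\<close>
    have "(\<Sum>i<k. of_int q * u i - 1 / real N) \<le> (\<Sum>i<k. real_of_int (p i))"
      using p by (intro sum_mono) (smt (verit) lessThan_iff)
    moreover have "(\<Sum>i<k. of_int q * u i - 1 / real N) = of_int q - k / real N"
      using u(2) by (simp add: sum_subtractf flip: sum_distrib_left)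
    moreover have "k / real N < 1" using N by simp
    moreover have "real_of_int q \<ge> 1" using q by simp
    ultimately show ?thesis by linarith
  qed
  then have "\<exists>i<k. p i \<noteq> 0" by (metis lessThan_iff less_irrefl of_int_0 sum.neutral)
  then have nz: "\<exists>i<k. nat (p i) \<noteq> 0" using pos by (metis int_nat_eq of_nat_0)
  have "(\<Sum>i<k. of_int (p i) * x i $ j) = 0" for j
  proof -
    have u0: "(\<Sum>i<k. u i * x i $ j) = 0"
      using arg_cong[OF x(2), of "\<lambda>v. v $ j"] by (simp add: sum_component)
    let ?s = "\<Sum>i<k. of_int (p i) * (real d * x i $ j)"
    \<comment> \<open>Subtracting a multiple of the vanishing relation turns the coefficients into
      approximation errors.\<close>
    have "?s = ?s - of_int q * real d * (\<Sum>i<k. u i * x i $ j)"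
      using u0 by simp
    also have "\<dots> = (\<Sum>i<k. (of_int (p i) - of_int q * u i) * (real d * x i $ j))"
      by (simp add: sum_distrib_left algebra_simps flip: sum_subtractf)
    finally have "?s = \<dots>" .
    then have "\<bar>?s\<bar> \<le> (\<Sum>i<k. \<bar>(of_int (p i) - of_int q * u i) * (real d * x i $ j)\<bar>)"
      by (simp only: sum_abs)
    also have "\<dots> \<le> (\<Sum>i<k. 1 / real N * (real d * \<bar>x i $ j\<bar>))"
      unfolding abs_mult abs_of_nat using p
      by (intro sum_mono mult_right_mono) (auto simp: abs_minus_commute less_imp_le)
    \<comment> \<open>Summing over all coordinates gives a bound that is the same for every
      \<open>j\<close>.\<close>
    also have "\<dots> \<le> (\<Sum>i<k. 1 / real N * (\<Sum>j\<in>UNIV. real d * \<bar>x i $ j\<bar>))"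
      by (intro sum_mono mult_left_mono member_le_sum) auto
    also have "\<dots> = M / N" by (simp add: M_def sum_divide_distrib)
    also have "\<dots> < 1" using N by simp
    finally have "\<bar>?s\<bar> < 1" .
    moreover have "?s \<in> \<int>" by (intro Ints_sum Ints_mult[OF Ints_of_int d(2)]) auto
    ultimately have "?s = 0" using Ints_nonzero_abs_less1 by blast
    moreover have "?s = real d * (\<Sum>i<k. of_int (p i) * x i $ j)"
      by (simp add: sum_distrib_left mult_ac)
    ultimately show ?thesis using d(1) by simp
  qed
  then have "(\<Sum>i<k. real (nat (p i)) *\<^sub>R x i) = 0"
    using pos by (simp add: vec_eq_iff sum_component)
  then show ?thesis using nz by (intro exI[of _ "\<lambda>i. nat (p i)"]) blast
qed

text \<open>Rationality is essential: on the line, 1 and minus the square root of 2 generate an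
  additive semigroup without 0 whose convex hull contains 0.\<close>

lemma zero_notin_convex_hull_semigroup:
  fixes P :: "(real ^ 'n) set"
  assumes rat: "\<And>v j. v \<in> P \<Longrightarrow> v $ j \<in> \<rat>"
    and add: "\<And>v w. v \<in> P \<Longrightarrow> w \<in> P \<Longrightarrow> v + w \<in> P" and "0 \<notin> P"
  shows "0 \<notin> convex hull P"
proof
  assume "0 \<in> convex hull P"
  then obtain S u where S: "finite S" "S \<subseteq> P" "\<forall>s\<in>S. 0 \<le> u s" "sum u S = 1"
    "(\<Sum>s\<in>S. u s *\<^sub>R s) = 0"
    unfolding convex_hull_explicit by blast
  obtain x where x: "bij_betw x {..<card S} S"
    using ex_bij_betw_nat_finite[OF S(1)] by (auto simp: atLeast0LessThan)
  have xS: "x i \<in> S" if "i < card S" for i using x that by (auto dest: bij_betwE)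
  obtain m :: "nat \<Rightarrow> nat" where m: "\<exists>i<card S. m i \<noteq> 0"
    "(\<Sum>i<card S. real (m i) *\<^sub>R x i) = 0"
  proof -
    have "(\<Sum>i<card S. u (x i)) = 1" "(\<Sum>i<card S. u (x i) *\<^sub>R x i) = 0"
      using sum.reindex_bij_betw[OF x, of u] sum.reindex_bij_betw[OF x, of "\<lambda>s. u s *\<^sub>R s"] S
      by auto
    then show ?thesis
      using nat_relation_of_convex_relation[of "card S" "\<lambda>i. u (x i)" x] xS S(2,3) rat that by blast
  qed
  have mult: "n \<noteq> 0 \<Longrightarrow> real n *\<^sub>R v \<in> P" if "v \<in> P" for n v
  proof (induction n)
    case (Suc n)
    then show ?case using that add by (cases "n = 0") (auto simp: scaleR_add_left)
  qed simp
  \<comment> \<open>Some \<open>m i\<close> may be 0 while 0 is not in \<open>P\<close>, so a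
    partial sum enters \<open>P\<close> only from the first nonzero coefficient on.\<close>
  have "if \<exists>i<k. m i \<noteq> 0 then (\<Sum>i<k. real (m i) *\<^sub>R x i) \<in> P else (\<Sum>i<k. real (m i) *\<^sub>R x i) = 0"
    if "k \<le> card S" for k
    using that
  proof (induction k)
    case (Suc k)
    then have "x k \<in> P" using xS S by auto
    then show ?case using Suc mult[of "x k" "m k"] add
      by (cases "m k = 0") (auto simp: less_Suc_eq split: if_splits)
  qed simp
  then show False using m assms(3) by (metis order_refl)
qed

section \<open>Compatible orders on groups of rational vectors\<close>

lemma subgroup_rational_vectors_closed:
  fixes G :: "(real ^ 'n) set"
  assumes "subgroup G rational_vectors"
  shows "0 \<in> G" "x \<in> G \<Longrightarrow> y \<in> G \<Longrightarrow> x + y \<in> G" "x \<in> G \<Longrightarrow> - x \<in> G" "x \<in> G \<Longrightarrow> x $ j \<in> \<rat>"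
proof -
  interpret comm_group "rational_vectors :: (real ^ 'n) monoid"
    by (rule comm_group_rational_vectors)
  show "0 \<in> G" using subgroup.one_closed[OF assms] by (simp add: rational_vectors_def)
  show "x \<in> G \<Longrightarrow> y \<in> G \<Longrightarrow> x + y \<in> G"
    using subgroup.m_closed[OF assms, of x y] by (simp add: rational_vectors_def)
  show *: "x \<in> G \<Longrightarrow> x $ j \<in> \<rat>" for x j
    using subgroup.mem_carrier[OF assms, of x] by (simp add: rational_vectors_def)
  assume "x \<in> G"
  then have "inv\<^bsub>rational_vectors\<^esub> x = - x"
    using * by (intro inv_equality) (auto simp: rational_vectors_def)
  then show "- x \<in> G" using subgroup.m_inv_closed[OF assms \<open>x \<in> G\<close>] by simp
qed

text \<open>The basis is arbitrary here, not orthonormal. Distinct points differ in some coordinate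
  because a vector is recovered from its expansion, so \<open>lex_greater_add\<close>
  applies.\<close>

lemma coordinate_system_compatible:
  fixes xs :: "('a::euclidean_space \<Rightarrow> real) list"
  assumes "coordinate_system xs"
  shows "compatible_with_addition UNIV (lex_greater xs)"
proof -
  obtain es where es: "independent (set es)" "span (set es) = UNIV"
    and xs: "xs = map (\<lambda>e v. representation (set es) v e) es"
    using assms by (auto simp: coordinate_system_def ordered_basis_def)
  have separated: "\<exists>i<length xs. (xs ! i) a \<noteq> (xs ! i) b" if "a \<noteq> b" for a b
  proof (rule ccontr)
    assume "\<not> ?thesis"
    then have "\<forall>e\<in>set es. representation (set es) a e = representation (set es) b e"
      by (auto simp: xs in_set_conv_nth)
    then have "(\<Sum>e\<in>set es. representation (set es) a e *\<^sub>R e)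
        = (\<Sum>e\<in>set es. representation (set es) b e *\<^sub>R e)"
      by (intro sum.cong) auto
    then show False using that es by (simp add: sum_representation_eq)
  qed
  have additive: "x (a + c) = x a + x c" if "x \<in> set xs" for x a c
    using that es by (auto simp: xs representation_add)
  have "lex_greater xs (a + c) (b + c)" if "lex_greater xs a b" for a b c
  proof (rule lex_greater_add)
    show "\<exists>i<length xs. (xs ! i) a \<noteq> (xs ! i) b"
      using that by (intro separated) (simp add: lex_greater_def)
  qed (simp_all add: additive that)
  then show ?thesis unfolding compatible_with_addition_def by blast
qed

theorem theorem28:
  fixes G :: "(real ^ 'n) set"
    and gt :: "real ^ 'n \<Rightarrow> real ^ 'n \<Rightarrow> bool"
  assumes "subgroup G rational_vectors"
    and "strict_total_order_on G gt"
  shows "compatible_with_addition G gt \<longleftrightarrow>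
    (\<exists>xs :: (real ^ 'n \<Rightarrow> real) list. coordinate_system xs \<and>
      (\<forall>a\<in>G. \<forall>b\<in>G. gt a b \<longleftrightarrow> lex_greater xs a b))"
proof
  note G = subgroup_rational_vectors_closed[OF assms(1)]
  assume compat: "compatible_with_addition G gt"
  have diff: "a - b \<in> G" if "a \<in> G" "b \<in> G" for a b
    using G(2)[OF that(1) G(3)[OF that(2)]] by simp
  have irrefl: "\<not> gt a a" if "a \<in> G" for a
    using assms(2) that by (auto simp: strict_total_order_on_def irreflp_on_def)
  have trans: "gt a c" if "a \<in> G" "b \<in> G" "c \<in> G" "gt a b" "gt b c" for a b c
    using assms(2) that unfolding strict_total_order_on_def by (meson transp_onD)
  have total: "gt a b \<or> gt b a" if "a \<in> G" "b \<in> G" "a \<noteq> b" for a b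
    using assms(2) that by (auto simp: strict_total_order_on_def totalp_on_def)
  define P where "P = {g \<in> G. gt g 0}"
  have "v + w \<in> P" if "v \<in> P" "w \<in> P" for v w
  proof -
    have "gt (v + w) (0 + w)"
      using that compat G(1) unfolding P_def compatible_with_addition_def by blast
    then show ?thesis using that trans[of "v + w" w 0] G by (auto simp: P_def)
  qed
  then have "0 \<notin> convex hull P"
    using G irrefl by (intro zero_notin_convex_hull_semigroup) (auto simp: P_def)
  then obtain es :: "(real ^ 'n) list" where es: "distinct es" "pairwise orthogonal (set es)"
    "\<forall>e\<in>set es. norm e = 1" "span (set es) = UNIV" "\<forall>c\<in>convex hull P. lex_pos es c"
    using convex_lex_pos_orthonormal[of UNIV "convex hull P"] by auto
  have ind: "independent (set es)"
    using es(2,3) by (intro pairwise_orthogonal_independent) auto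
  define xs where "xs = map (\<lambda>e v. v \<bullet> e) es"
  have "representation (set es) v e = v \<bullet> e" if "e \<in> set es" for v e
    using that es ind by (intro orthonormal_representation) auto
  then have "xs = map (\<lambda>e v. representation (set es) v e) es"
    unfolding xs_def by (intro map_cong) auto
  then have "coordinate_system xs"
    using es ind unfolding coordinate_system_def ordered_basis_def by blast
  moreover have gt_lex: "lex_greater xs a b" if "a \<in> G" "b \<in> G" "gt a b" for a b
  proof -
    \<comment> \<open>Compatibility reduces the comparison of \<open>a\<close> and \<open>b\<close>
      to the positivity of \<open>a - b\<close>.\<close>
    have "gt (a + - b) (b + - b)"
      using that compat G(3) unfolding compatible_with_addition_def by blast
    then have "a - b \<in> P" using that diff by (simp add: P_def)
    then have "lex_pos es (a - b)" using es(5) by (simp add: hull_inc)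
    then show ?thesis unfolding xs_def by (rule lex_pos_imp_lex_greater)
  qed
  \<comment> \<open>One inclusion between the relations suffices: \<open>gt\<close> is total on
    \<open>G\<close> and \<open>lex_greater\<close> is asymmetric.\<close>
  moreover have "gt a b" if "a \<in> G" "b \<in> G" "lex_greater xs a b" for a b
  proof -
    have "a \<noteq> b" using that(3) by (simp add: lex_greater_def)
    moreover have "\<not> gt b a" using gt_lex[OF that(2,1)] lex_greater_asym[OF that(3)] by blast
    ultimately show ?thesis using that total by blast
  qed
  ultimately show "\<exists>xs. coordinate_system xs \<and> (\<forall>a\<in>G. \<forall>b\<in>G. gt a b \<longleftrightarrow> lex_greater xs a b)"
    by blast
next
  assume "\<exists>xs. coordinate_system xs \<and> (\<forall>a\<in>G. \<forall>b\<in>G. gt a b \<longleftrightarrow> lex_greater xs a b)"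
  \<comment> \<open>Closure of \<open>G\<close> under addition allows the equivalence to be read
    backwards at the translated pair.\<close>
  then show "compatible_with_addition G gt"
    using coordinate_system_compatible subgroup_rational_vectors_closed(2)[OF assms(1)]
    unfolding compatible_with_addition_def by (metis UNIV_I)
qed

end
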